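(* Let $v_1,v_2,w_1,w_2,w_3$ be weights with $w_2=w_3$, excluding the degenerate case $w_1=w_2=w_3=0$. Let $T$ and $X$ be the power series in $z$ defined in the context (with $w_3=w_2$). Then a solution, with free parameter $\lambda$, of the system of recurrence relations $$T_j=1+z\big(v_1T_{j-1}+v_1T_{j+1}+v_2T_j\big)+z\Big(w_1T_{j-1}T_{j+1}+w_2T_j^2+w_3T_j\big(T_{j-1}+T_{j+1}\big)\Big),\qquad j\in\mathbb{Z},$$ is given by $$T_j=T\cdot\left(1-\frac{\big(\frac{v_1}{T}+w_1+w_2\big)\,\lambda\,(1-X^2)(1-X^3)X^j}{\big(w_1X+w_2(1+X+X^2)\big)(1-\lambda X^{j+1})(1-\lambda X^{j+2})}\right),\qquad j\in\mathbb{Z}.$$ Here $\lambda$ is any element, independent of $j$, of the field of formal Laurent series in $z$ such that $1-\lambda X^{k}\neq 0$ for all $k\in\mathbb{Z}$.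
   Context: The quantities $v_1,v_2,w_1,w_2,w_3$ are either nonnegative real weights or indeterminates (with $w_3$ identified with $w_2$); all identities are in the field of formal Laurent series in $z$ over the field generated by the reals and these quantities. $T$ is the formal power series in $z$ with $T(0)=1$ satisfying $$T=1+z(2v_1+v_2)T+z(w_1+w_2+2w_3)T^2 .$$ $X$ is the formal power series in $z$ with zero constant term satisfying the characteristic equation $$1=z\Big(v_1\big(\tfrac1X+X\big)+v_2\Big)+zT\Big(w_1\big(\tfrac1X+X\big)+2w_2+w_3\big(\tfrac1X+2+X\big)\Big),$$ that is, $$X=\frac{1-z(v_2+2T(w_2+w_3))-\sqrt{\big(1-z(v_2+2T(w_2+w_3))\big)^2-4z^2(v_1+T(w_1+w_3))^2}}{2z(v_1+T(w_1+w_3))}.$$ *)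

theory Defs
  imports "HOL-Computational_Algebra.Computational_Algebra" Complex_Main
begin

text \<open>
  Algebraic independence over the reals of the family \<open>q\<close> indexed by the finite set \<open>I\<close>. An exponent
  vector \<open>m\<close> vanishes outside \<open>I\<close>, so that different exponent vectors give different monomials,
  and \<open>M\<close>, \<open>c\<close> describe a real polynomial in the variables indexed by \<open>I\<close>.
\<close>

definition alg_independent :: "'i set \<Rightarrow> ('i \<Rightarrow> 'k::real_field) \<Rightarrow> bool" where
  "alg_independent I q \<longleftrightarrow>
     (\<forall>(M :: ('i \<Rightarrow> nat) set) (c :: ('i \<Rightarrow> nat) \<Rightarrow> real).
        finite M \<and> (\<forall>m\<in>M. \<forall>i. i \<notin> I \<longrightarrow> m i = 0) \<and>
        (\<Sum>m\<in>M. of_real (c m) * (\<Prod>i\<in>I. q i ^ m i)) = 0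
        \<longrightarrow> (\<forall>m\<in>M. c m = 0))"

text \<open>
  The entries of a list are weights if those at the positions in \<open>I\<close> are (independent)
  indeterminates over the reals and all the others are nonnegative reals, everything living in
  some field extension \<open>'k\<close> of the reals. The case of real weights is \<open>I = {}\<close>.
\<close>

definition weights :: "'k::real_field list \<Rightarrow> bool" where
  "weights qs \<longleftrightarrow>
     (\<exists>I. I \<subseteq> {..<length qs} \<and> alg_independent I ((!) qs) \<and>
          (\<forall>i\<in>{..<length qs} - I. \<exists>r::real. r \<ge> 0 \<and> qs ! i = of_real r))"

definition T_equation :: "'k \<Rightarrow> 'k \<Rightarrow> 'k \<Rightarrow> 'k \<Rightarrow> 'k \<Rightarrow> 'k::field fps \<Rightarrow> bool" where
  "T_equation v1 v2 w1 w2 w3 T \<longleftrightarrow>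
     T = 1 + fps_X * fps_const (2 * v1 + v2) * T
           + fps_X * fps_const (w1 + w2 + 2 * w3) * T ^ 2"

text \<open>
  In the characteristic equation \<open>t\<close> and \<open>x\<close> are \<open>T\<close> and \<open>X\<close> viewed as Laurent series. The
  convention \<open>1 / 0 = 0\<close> does not admit the spurious solution \<open>x = 0\<close>: the right-hand side would
  then have zero constant coefficient.
\<close>

definition characteristic_equation ::
  "'k \<Rightarrow> 'k \<Rightarrow> 'k \<Rightarrow> 'k \<Rightarrow> 'k \<Rightarrow> 'k::field fls \<Rightarrow> 'k fls \<Rightarrow> bool" where
  "characteristic_equation v1 v2 w1 w2 w3 t x \<longleftrightarrow>
     1 = fls_X * (fls_const v1 * (1 / x + x) + fls_const v2)
       + fls_X * t * (fls_const w1 * (1 / x + x) + 2 * fls_const w2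
                      + fls_const w3 * (1 / x + 2 + x))"

definition recurrence_system ::
  "'k \<Rightarrow> 'k \<Rightarrow> 'k \<Rightarrow> 'k \<Rightarrow> 'k \<Rightarrow> (int \<Rightarrow> 'k::field fls) \<Rightarrow> bool" where
  "recurrence_system v1 v2 w1 w2 w3 \<tau> \<longleftrightarrow>
     (\<forall>j. \<tau> j = 1
        + fls_X * (fls_const v1 * \<tau> (j - 1) + fls_const v1 * \<tau> (j + 1) + fls_const v2 * \<tau> j)
        + fls_X * (fls_const w1 * \<tau> (j - 1) * \<tau> (j + 1) + fls_const w2 * \<tau> j ^ 2
                   + fls_const w3 * \<tau> j * (\<tau> (j - 1) + \<tau> (j + 1))))"

end

theory Submission
  imports Defs
begin

text \<open>
  Write the claimed solution as \<open>T\<^sub>j = T (1 - s\<^sub>j)\<close>. Subtracting from the recurrence for \<open>T\<^sub>j\<close> the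
  equation for \<open>T\<close> and \<open>s\<^sub>j\<close> times the characteristic equation, the variable \<open>z\<close> factors out and what
  remains, with \<open>a = v\<^sub>1 / T + w\<^sub>1 + w\<^sub>2\<close>, is
  \<open>a (s\<^sub>j\<^sub>-\<^sub>1 + s\<^sub>j\<^sub>+\<^sub>1 - (X + 1 / X) s\<^sub>j) = w\<^sub>1 s\<^sub>j\<^sub>-\<^sub>1 s\<^sub>j\<^sub>+\<^sub>1 + w\<^sub>2 s\<^sub>j (s\<^sub>j\<^sub>-\<^sub>1 + s\<^sub>j + s\<^sub>j\<^sub>+\<^sub>1)\<close>.
  The profile \<open>r\<^sub>j = \<lambda> X\<^sup>j / ((1 - \<lambda> X\<^sup>j\<^sup>+\<^sup>1) (1 - \<lambda> X\<^sup>j\<^sup>+\<^sup>2))\<close> makes the second difference on the left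
  proportional to each of the two quadratic expressions on the right, so that a suitable multiple
  of it solves the equation for any \<open>w\<^sub>1\<close> and \<open>w\<^sub>2\<close>.
\<close>

text \<open>With \<open>y\<close> standing for \<open>\<lambda> X^(j-1)\<close>, the terms
  \<open>p\<close>, \<open>q\<close>, \<open>r\<close> are three consecutive profile values.
  Clearing denominators turns both claims into polynomial identities in \<open>x\<close> and
  \<open>y\<close>.\<close>

lemma profile_identities:
  fixes x y :: "'a::field"
  assumes "1 - y * x \<noteq> 0" "1 - y * x ^ 2 \<noteq> 0" "1 - y * x ^ 3 \<noteq> 0" "1 - y * x ^ 4 \<noteq> 0"
  defines "p \<equiv> y / ((1 - y * x) * (1 - y * x ^ 2))"
    and "q \<equiv> y * x / ((1 - y * x ^ 2) * (1 - y * x ^ 3))"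
    and "r \<equiv> y * x ^ 2 / ((1 - y * x ^ 3) * (1 - y * x ^ 4))"
    and "P \<equiv> (1 - x ^ 2) * (1 - x ^ 3)"
  shows "x * (p + r) - (x ^ 2 + 1) * q = P * (p * r)"
    and "(1 + x + x ^ 2) * (x * (p + r) - (x ^ 2 + 1) * q) = x * P * (q * (p + q + r))"
proof -
  define b1 b2 b3 b4 where b: "b1 = 1 - y * x" "b2 = 1 - y * x ^ 2" "b3 = 1 - y * x ^ 3" "b4 = 1 - y * x ^ 4"
  have nz: "b1 \<noteq> 0" "b2 \<noteq> 0" "b3 \<noteq> 0" "b4 \<noteq> 0"
    using assms(1-4) by (simp_all add: b)
  define M where "M = b1 * b2 * b3 * b4"
  have M: "M \<noteq> 0" using nz by (simp add: M_def)
  have p: "M * p = y * b3 * b4" and q: "M * q = y * x * b1 * b4" and r: "M * r = y * x ^ 2 * b1 * b2"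
    using nz unfolding p_def q_def r_def M_def b[symmetric] by simp_all
  have pr: "M * (p * r) = y ^ 2 * x ^ 2"
    using nz unfolding p_def r_def M_def b[symmetric] by (simp add: power2_eq_square)
  have "M * (x * (p + r) - (x ^ 2 + 1) * q) = x * (M * p + M * r) - (x ^ 2 + 1) * (M * q)"
    by (simp add: algebra_simps)
  also have "\<dots> = P * (M * (p * r))"
    unfolding p q r pr b P_def by algebra
  also have "\<dots> = M * (P * (p * r))" by simp
  finally show "x * (p + r) - (x ^ 2 + 1) * q = P * (p * r)" using M by simp
  \<comment> \<open>The products in \<open>q * (p + q + r)\<close> repeat denominator factors such
    as \<open>b2\<close>, hence the square of \<open>M\<close>.\<close>
  have "M ^ 2 * ((1 + x + x ^ 2) * (x * (p + r) - (x ^ 2 + 1) * q))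
      = M * ((1 + x + x ^ 2) * (x * (M * p + M * r) - (x ^ 2 + 1) * (M * q)))"
    by (simp add: algebra_simps power2_eq_square)
  also have "\<dots> = x * P * (M * q * (M * p + M * q + M * r))"
    unfolding p q r unfolding M_def b P_def by algebra
  also have "\<dots> = M ^ 2 * (x * P * (q * (p + q + r)))"
    by (simp add: algebra_simps power2_eq_square)
  finally show "(1 + x + x ^ 2) * (x * (p + r) - (x ^ 2 + 1) * q) = x * P * (q * (p + q + r))"
    using M by simp
qed

text \<open>Scaling the profile by \<open>c\<close> multiplies the linear side by \<open>c\<close>
  and the quadratic side by \<open>c ^ 2\<close>. Adding \<open>w1 * x\<close> times the first
  profile identity to \<open>w2\<close> times the second gives the factor \<open>D\<close>, so the
  balance \<open>c * D = a * P\<close> dictates \<open>c\<close>.\<close>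

lemma scaled_profile_equation:
  fixes x y a w1 w2 :: "'a::field"
  assumes "x \<noteq> 0" and D: "w1 * x + w2 * (1 + x + x ^ 2) \<noteq> 0"
    and "1 - y * x \<noteq> 0" "1 - y * x ^ 2 \<noteq> 0" "1 - y * x ^ 3 \<noteq> 0" "1 - y * x ^ 4 \<noteq> 0"
  defines "c \<equiv> a * ((1 - x ^ 2) * (1 - x ^ 3)) / (w1 * x + w2 * (1 + x + x ^ 2))"
  defines "p \<equiv> c * (y / ((1 - y * x) * (1 - y * x ^ 2)))"
    and "q \<equiv> c * (y * x / ((1 - y * x ^ 2) * (1 - y * x ^ 3)))"
    and "r \<equiv> c * (y * x ^ 2 / ((1 - y * x ^ 3) * (1 - y * x ^ 4)))"
  shows "a * (p + r - (x + 1 / x) * q) = w1 * p * r + w2 * q * (p + q + r)"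
proof -
  define p' q' r' where s: "p' = y / ((1 - y * x) * (1 - y * x ^ 2))"
    "q' = y * x / ((1 - y * x ^ 2) * (1 - y * x ^ 3))"
    "r' = y * x ^ 2 / ((1 - y * x ^ 3) * (1 - y * x ^ 4))"
  define P D where "P = (1 - x ^ 2) * (1 - x ^ 3)" and "D = w1 * x + w2 * (1 + x + x ^ 2)"
  define d where "d = x * (p' + r') - (x ^ 2 + 1) * q'"
  have id: "d = P * (p' * r')" "(1 + x + x ^ 2) * d = x * P * (q' * (p' + q' + r'))"
    unfolding d_def P_def s by (intro profile_identities assms(3-6))+
  have cD: "c * D = a * P"
    using D by (simp add: c_def D_def P_def)
  have "D * d = w1 * x * d + w2 * ((1 + x + x ^ 2) * d)"
    by (simp add: D_def algebra_simps)
  also have "\<dots> = x * P * (w1 * (p' * r') + w2 * (q' * (p' + q' + r')))"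
    unfolding id(2) by (subst id(1)) (simp add: algebra_simps)
  finally have Dd: "D * d = x * P * (w1 * (p' * r') + w2 * (q' * (p' + q' + r')))" .
  \<comment> \<open>Multiplying by \<open>D\<close> lets \<open>a * P\<close> be replaced by
    \<open>c * D\<close>; then \<open>D\<close>, which is nonzero, cancels.\<close>
  have "D * (a * c * d) = (a * P) * c * (x * (w1 * (p' * r') + w2 * (q' * (p' + q' + r'))))"
    using Dd by algebra
  also have "\<dots> = D * (c ^ 2 * (x * (w1 * (p' * r') + w2 * (q' * (p' + q' + r')))))"
    by (simp add: cD[symmetric] power2_eq_square)
  finally have "a * c * d = c ^ 2 * (x * (w1 * (p' * r') + w2 * (q' * (p' + q' + r'))))"
    using D unfolding D_def by simp
  also have "\<dots> = x * (w1 * p * r + w2 * q * (p + q + r))"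
    unfolding p_def q_def r_def s[symmetric] by algebra
  also have "a * c * d = x * (a * (p + r - (x + 1 / x) * q))"
    unfolding p_def q_def r_def s[symmetric] d_def
    using \<open>x \<noteq> 0\<close> by (simp add: field_simps power2_eq_square)
  finally show ?thesis using \<open>x \<noteq> 0\<close> by simp
qed

text \<open>Here \<open>x'\<close> stands for \<open>1 / x\<close>, which keeps all relations
  polynomial. The claim is the equation for \<open>t\<close>, minus \<open>t * q\<close> times
  \<open>char_eq\<close>, plus \<open>z * t\<close> times \<open>dev\<close>, up to
  rearrangement.\<close>

lemma recurrence_of_deviation_equation:
  fixes z t :: "'a::field"
  assumes t_eq: "t = 1 + z * (2 * v1 + v2) * t + z * (w1 + 3 * w2) * t ^ 2"
    and char_eq: "1 = z * (v1 * (x' + x) + v2)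
                      + z * t * (w1 * (x' + x) + 2 * w2 + w2 * (x' + 2 + x))"
    and dev: "(v1 + t * (w1 + w2)) * (p + r - (x + x') * q) = t * (w1 * p * r + w2 * q * (p + q + r))"
  shows "t * (1 - q) = 1 + z * (v1 * (t * (1 - p)) + v1 * (t * (1 - r)) + v2 * (t * (1 - q)))
    + z * (w1 * (t * (1 - p)) * (t * (1 - r)) + w2 * (t * (1 - q)) ^ 2
           + w2 * (t * (1 - q)) * (t * (1 - p) + t * (1 - r)))"
  using assms by algebra

text \<open>The product is a power series with constant coefficient 0. This serves to exclude
  \<open>x = 0\<close>.\<close>

lemma fls_X_mult_fps_to_fls_neq_1:
  fixes f :: "'a::field fps"
  shows "fls_X * fps_to_fls f \<noteq> 1"
proof
  assume "fls_X * fps_to_fls f = 1"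
  then have "fps_to_fls (fps_X * f) = fps_to_fls 1"
    by (simp add: fls_times_fps_to_fls fps_X_to_fls)
  then have "fps_nth (fps_X * f) 0 = fps_nth 1 0"
    by (simp only: fps_to_fls_eq_iff)
  then show False by simp
qed

theorem theorem1:
  fixes v1 v2 w1 w2 w3 :: "'k::real_field"
    and T X :: "'k fps" and t x lam :: "'k fls"
  assumes weights: "weights [v1, v2, w1, w2]"
    and w3: "w2 = w3"
    and nondegenerate: "\<not> (w1 = 0 \<and> w2 = 0 \<and> w3 = 0)"
    and T_0: "fps_nth T 0 = 1"
    and T_eq: "T_equation v1 v2 w1 w2 w3 T"
    and X_0: "fps_nth X 0 = 0"
    and t_def: "t = fps_to_fls T"
    and x_def: "x = fps_to_fls X"
    and X_eq: "characteristic_equation v1 v2 w1 w2 w3 t x"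
    and lam: "\<forall>k::int. 1 - lam * x powi k \<noteq> 0"
  shows "recurrence_system v1 v2 w1 w2 w3
    (\<lambda>j. t * (1 -
        ((fls_const v1 / t + fls_const w1 + fls_const w2) * lam * (1 - x ^ 2) * (1 - x ^ 3) * x powi j)
        / ((fls_const w1 * x + fls_const w2 * (1 + x + x ^ 2))
           * (1 - lam * x powi (j + 1)) * (1 - lam * x powi (j + 2)))))"
proof -
  let ?c = "fls_const :: 'k \<Rightarrow> 'k fls"
  have T_sub: "t = 1 + fls_X * (2 * ?c v1 + ?c v2) * t + fls_X * (?c w1 + 3 * ?c w2) * t ^ 2"
  proof -
    have "T = 1 + fps_X * (2 * fps_const v1 + fps_const v2) * T
        + fps_X * (fps_const w1 + 3 * fps_const w2) * T ^ 2"
      using T_eq unfolding T_equation_def w3[symmetric]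
      by (simp add: algebra_simps fps_const_add[symmetric] fps_const_mult[symmetric] numeral_fps_const
          del: fps_const_add fps_const_mult)
    then have "fps_to_fls T = fps_to_fls (1 + fps_X * (2 * fps_const v1 + fps_const v2) * T
        + fps_X * (fps_const w1 + 3 * fps_const w2) * T ^ 2)" by simp
    then show ?thesis
      by (simp add: t_def fls_times_fps_to_fls fps_to_fls_power fps_X_to_fls)
  qed
  have "t \<noteq> 0"
    using T_0 by (auto simp: t_def)
  have "x \<noteq> 0"
  proof
    assume "x = 0"
    \<comment> \<open>Since \<open>1 / 0 = 0\<close>, only the terms free of \<open>x\<close>
      survive; \<open>2 * w2 + 2 * w3\<close> becomes \<open>4 * w2\<close>.\<close>
    then have "fls_X * fps_to_fls (fps_const v2 + T * (4 * fps_const w2)) = 1"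
      using X_eq unfolding characteristic_equation_def w3[symmetric]
      by (simp add: t_def fls_times_fps_to_fls algebra_simps)
    then show False
      using fls_X_mult_fps_to_fls_neq_1 by blast
  qed
  have D: "?c w1 * x + ?c w2 * (1 + x + x ^ 2) \<noteq> 0"
  proof (cases "w2 = 0")
    case True
    then show ?thesis using nondegenerate w3 \<open>x \<noteq> 0\<close> by simp
  next
    case False
    \<comment> \<open>As \<open>X\<close> has zero constant term, the constant coefficient is
      \<open>w2\<close>.\<close>
    then have "fps_const w1 * X + fps_const w2 * (1 + X + X ^ 2) \<noteq> 0"
      using X_0 by (auto simp: fps_eq_iff power2_eq_square intro!: exI[of _ 0])
    then have "fps_to_fls (fps_const w1 * X + fps_const w2 * (1 + X + X ^ 2)) \<noteq> 0"
      by (simp only: fps_to_fls_eq_0_iff not_False_eq_True)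
    then show ?thesis
      by (simp add: x_def fls_times_fps_to_fls fps_to_fls_power)
  qed
  define a where "a = ?c v1 / t + ?c w1 + ?c w2"
  define c where "c = a * ((1 - x ^ 2) * (1 - x ^ 3)) / (?c w1 * x + ?c w2 * (1 + x + x ^ 2))"
  define s where "s j = c * (lam * x powi j / ((1 - lam * x powi (j + 1)) * (1 - lam * x powi (j + 2))))"
    for j
  have rec: "t * (1 - s j) = 1 + fls_X * (?c v1 * (t * (1 - s (j - 1))) + ?c v1 * (t * (1 - s (j + 1)))
      + ?c v2 * (t * (1 - s j)))
    + fls_X * (?c w1 * (t * (1 - s (j - 1))) * (t * (1 - s (j + 1))) + ?c w2 * (t * (1 - s j)) ^ 2
           + ?c w2 * (t * (1 - s j)) * (t * (1 - s (j - 1)) + t * (1 - s (j + 1))))" for j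
  proof -
    \<comment> \<open>Starting at index \<open>j - 1\<close> turns all integer powers involved into
      \<open>y\<close> times natural powers of \<open>x\<close>, with exponents at most 4.\<close>
    define y where "y = lam * x powi (j - 1)"
    have y: "lam * x powi (j - 1 + int n) = y * x ^ n" for n
      using \<open>x \<noteq> 0\<close> by (simp add: y_def power_int_add)
    note y_simps = y[of 1, simplified] y[of 2, simplified] y[of 3, simplified] y[of 4, simplified]
    have nz: "1 - y * x ^ n \<noteq> 0" for n
      using lam by (simp add: y[symmetric])
    have s_eqs: "s (j - 1) = c * (y / ((1 - y * x) * (1 - y * x ^ 2)))"
      "s j = c * (y * x / ((1 - y * x ^ 2) * (1 - y * x ^ 3)))"
      "s (j + 1) = c * (y * x ^ 2 / ((1 - y * x ^ 3) * (1 - y * x ^ 4)))"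
      using y_simps by (simp_all add: s_def y_def[symmetric] algebra_simps)
    have "a * (s (j - 1) + s (j + 1) - (x + 1 / x) * s j)
        = ?c w1 * s (j - 1) * s (j + 1) + ?c w2 * s j * (s (j - 1) + s j + s (j + 1))"
      unfolding s_eqs c_def
      by (rule scaled_profile_equation) (use nz[of 1] nz[of 2] nz[of 3] nz[of 4] \<open>x \<noteq> 0\<close> D in simp_all)
    \<comment> \<open>Multiplication by \<open>t\<close> removes the quotient \<open>v1 / t\<close>
      from \<open>a\<close>.\<close>
    moreover have "?c v1 + t * (?c w1 + ?c w2) = t * a"
      using \<open>t \<noteq> 0\<close> by (simp add: a_def field_simps)
    ultimately have dev: "(?c v1 + t * (?c w1 + ?c w2)) * (s (j - 1) + s (j + 1) - (x + 1 / x) * s j)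
        = t * (?c w1 * s (j - 1) * s (j + 1) + ?c w2 * s j * (s (j - 1) + s j + s (j + 1)))"
      by simp
    show ?thesis
      by (rule recurrence_of_deviation_equation[OF T_sub _ dev])
        (use X_eq in \<open>simp add: characteristic_equation_def w3[symmetric]\<close>)
  qed
  have sol: "(\<lambda>j. t * (1 -
        ((?c v1 / t + ?c w1 + ?c w2) * lam * (1 - x ^ 2) * (1 - x ^ 3) * x powi j)
        / ((?c w1 * x + ?c w2 * (1 + x + x ^ 2))
           * (1 - lam * x powi (j + 1)) * (1 - lam * x powi (j + 2))))) = (\<lambda>j. t * (1 - s j))"
    by (simp add: s_def c_def a_def mult_ac)
  show ?thesis
    unfolding sol recurrence_system_def w3[symmetric] by (intro allI rec)
qed

end
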